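(* Let $(E,\|\cdot\|_E)$ and $(W,\|\cdot\|_W)$ be real Banach spaces, $\Omega$ an open subset of $E$, $f_0,\dots,f_m:\Omega\to\mathbb{R}$ functions and $h:\Omega\to W$ a mapping. Let $\hat{x}$ be a solution of the problem $$(\mathcal{H}_1)\qquad \max f_0(x)\quad\text{subject to } x\in\Omega,\ f_i(x)\ge0\ \text{for all } i\in\{1,\dots,m\},\ h(x)=0.$$ Assume: (a) for every $i\in\{0,\dots,m\}$, $f_i$ is Lipschitz in a neighborhood of $\hat{x}$; (b) $h$ is Fréchet differentiable in a neighborhood of $\hat{x}$, the Fréchet differential $x\mapsto d_Fh(x)$ is continuous at $\hat{x}$, and $\operatorname{Im} d_Fh(\hat{x})$ is closed in $W$; (c) $\operatorname{Ker}(d_Fh(\hat{x}))$ is complemented in $E$, i.e. there is a closed subspace $E_1$ of $E$ with $E=\operatorname{Ker}(d_Fh(\hat{x}))\oplus E_1$. Then there exist $\lambda^0,\dots,\lambda^m\in\mathbb{R}_+$ and $w_0^*\in W^*$ such that: (i) $(\lambda^0,\dots,\lambda^m,w_0^* )\neq(0,\dots,0,0_{W^*})$; (ii) $\lambda^if_i(\hat{x})=0$ for all $i\in\{1,\dots,m\}$; (iii) $\sum_{i=0}^m\lambda^iD^-_Mf_i(\hat{x})(u)+\langle w_0^*,d_Fh(\hat{x})(u)\rangle\le0$ for all $u\in E$. Moreover, these multipliers can be chosen so that: if $d_Fh(\hat{x})$ is not onto, then $(\lambda^0,\dots,\lambda^m,w_0^* )=(0,\dots,0,w_0^* )$ with $w_0^*\neq0$;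 if $d_Fh(\hat{x})$ is onto, then $(\lambda^0,\dots,\lambda^m)\neq(0,\dots,0)$, and if furthermore there exists $w\in\operatorname{Ker}(d_Fh(\hat{x}))$ with $D^-_Mf_j(\hat{x})(w)>0$ for every $j\in\{i\in\{1,\dots,m\}:f_i(\hat{x})=0\}$, then one can choose $\lambda^0=1$.
   Context: For a function $f$ defined near $x$ and $u\in E$: $D^-f(x)(u):=\liminf_{t\to0^+}\frac{f(x+tu)-f(x)}{t}$ (with $D^-f(x)(0)=0$), and the modified lower Dini derivative is $D^-_Mf(x)(u):=\inf_{w\in E}\{D^-f(x)(u+w)-D^-f(x)(w)\}$. $W^*$ denotes the topological dual of $W$. *)

theory Defs
  imports "HOL-Analysis.Analysis"
begin

text \<open>Lower Dini directional derivative (extended-real valued):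
  liminf as t tends to 0 from the right of (f(x+tu)-f(x))/t.  For u = 0 the
  quotient is identically 0, so the convention D^-f(x)(0)=0 holds automatically.\<close>
definition lower_dini :: "('a::real_normed_vector \<Rightarrow> real) \<Rightarrow> 'a \<Rightarrow> 'a \<Rightarrow> ereal" where
  "lower_dini f x u = Liminf (at_right (0::real)) (\<lambda>t. ereal ((f (x + t *\<^sub>R u) - f x) / t))"

definition modified_lower_dini :: "('a::real_normed_vector \<Rightarrow> real) \<Rightarrow> 'a \<Rightarrow> 'a \<Rightarrow> ereal" where
  "modified_lower_dini f x u = (INF w. lower_dini f x (u + w) - lower_dini f x w)"

end

theory Submission
  imports Defs
begin

text \<open>For Lipschitz \<open>f\<close>, \<open>\<phi> = - D\<^sup>-\<^sub>M f(xhat)\<close> is real-valued and sublinear, and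
  \<open>- \<phi> \<le> D\<^sup>- f(xhat)\<close>. If \<open>A = d h(xhat)\<close> is not onto, Hahn-Banach gives a nonzero functional
  vanishing on its closed range. If it is onto, a complement of the kernel gives a bounded right
  inverse of \<open>A\<close>, so every kernel direction is tangent to \<open>{h = 0}\<close>; by optimality no kernel
  direction makes \<open>\<phi>\<^sub>0\<close> and all active \<open>\<phi>\<^sub>i\<close> negative. A theorem of the alternative then yields
  \<open>q = \<Sum> \<lambda>\<^sub>i \<phi>\<^sub>i \<ge> 0\<close> on the kernel, and Hahn-Banach on the codomain yields \<open>w\<^sub>0\<close> with
  \<open>w\<^sub>0 \<circ> A \<le> q\<close>.\<close>

section \<open>Sublinear functionals and the Hahn-Banach theorem\<close>

text \<open>The lower Dini derivative D^- is positively homogeneous but need not be superadditive,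
  so neither Hahn-Banach nor the alternative applies to it. In the modified derivative the
  differences D^-(u + w) - D^-(w) telescope, which yields superadditivity, and w = 0 keeps it below
  D^-. The Lipschitz assumption serves twice: it makes these derivatives finite, and it lets a
  strict ascent survive a displacement of size e * t, which is what permits a return to h = 0. The
  right inverse of \<open>A\<close> serves twice as well: it turns that return into a fixed point
  problem in the codomain, and it makes the functional below the value function bounded. Looking for
  the functional on the codomain avoids factoring a functional on the domain through
  \<open>A\<close>.\<close>

definition sublinear :: "('a::real_vector \<Rightarrow> real) \<Rightarrow> bool" where
  "sublinear p \<longleftrightarrow> (\<forall>x y. p (x + y) \<le> p x + p y) \<and> (\<forall>c x. c > 0 \<longrightarrow> p (c *\<^sub>R x) = c * p x)"

lemma sublinearI:
  assumes "\<And>x y. p (x + y) \<le> p x + p y" and "\<And>c x. c > 0 \<Longrightarrow> p (c *\<^sub>R x) = c * p x"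
  shows "sublinear p"
  using assms by (simp add: sublinear_def)

lemma sublinear_add: "sublinear p \<Longrightarrow> p (x + y) \<le> p x + p y"
  by (simp add: sublinear_def)

lemma sublinear_scaleR_pos: "sublinear p \<Longrightarrow> c > 0 \<Longrightarrow> p (c *\<^sub>R x) = c * p x"
  by (simp add: sublinear_def)

text \<open>Homogeneity at c = 2 forces this, so the definition can ask for positive factors only
  and no construction below has to treat c = 0.\<close>

lemma sublinear_zero: "sublinear p \<Longrightarrow> p 0 = 0"
  using sublinear_scaleR_pos[of p 2 0] by simp

lemma sublinear_scaleR: "sublinear p \<Longrightarrow> c \<ge> 0 \<Longrightarrow> p (c *\<^sub>R x) = c * p x"
  using sublinear_scaleR_pos[of p c x] sublinear_zero[of p] by (cases "c = 0") auto

lemma sublinear_minus: "sublinear p \<Longrightarrow> - p (- x) \<le> p x"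
  using sublinear_add[of p x "- x"] sublinear_zero[of p] by simp

lemma sublinear_sum:
  assumes "\<And>i. i \<in> I \<Longrightarrow> sublinear (g i)" and "\<And>i. i \<in> I \<Longrightarrow> l i \<ge> (0::real)"
  shows "sublinear (\<lambda>x. \<Sum>i\<in>I. l i * g i x)"
proof (rule sublinearI)
  fix x y
  have "(\<Sum>i\<in>I. l i * g i (x + y)) \<le> (\<Sum>i\<in>I. l i * g i x + l i * g i y)"
    by (intro sum_mono) (simp add: assms distrib_left[symmetric] mult_left_mono sublinear_add)
  then show "(\<Sum>i\<in>I. l i * g i (x + y)) \<le> (\<Sum>i\<in>I. l i * g i x) + (\<Sum>i\<in>I. l i * g i y)"
    by (simp add: sum.distrib)
next
  fix c :: real and x assume "c > 0"
  then show "(\<Sum>i\<in>I. l i * g i (c *\<^sub>R x)) = c * (\<Sum>i\<in>I. l i * g i x)"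
    by (auto simp: sum_distrib_left assms sublinear_scaleR_pos intro!: sum.cong)
qed

text \<open>Every member satisfies -p(-x) \<le> -q(-x) \<le> q x, so the common bound
  \<open>p\<close> keeps the pointwise infimum finite. The chain enters in subadditivity: two
  members q and r are replaced by the smaller one, whose own subadditivity bounds the infimum at x +
  y by q x + r y.\<close>

lemma sublinear_INF_chain:
  assumes "C \<noteq> {}" and sub: "\<And>q. q \<in> C \<Longrightarrow> sublinear q"
    and le: "\<And>q x. q \<in> C \<Longrightarrow> q x \<le> p x"
    and chain: "\<And>q r. q \<in> C \<Longrightarrow> r \<in> C \<Longrightarrow> (\<forall>x. q x \<le> r x) \<or> (\<forall>x. r x \<le> q x)"
  shows "sublinear (\<lambda>x. INF q\<in>C. q x)" and "\<And>q x. q \<in> C \<Longrightarrow> (INF q\<in>C. q x) \<le> q x"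
proof -
  have bdd: "bdd_below ((\<lambda>q. q x) ` C)" for x
  proof (rule bdd_belowI2)
    fix q assume "q \<in> C"
    then show "- p (- x) \<le> q x"
      using sublinear_minus[OF sub, of q x] le[of q "- x"] by linarith
  qed
  show low: "\<And>q x. q \<in> C \<Longrightarrow> (INF q\<in>C. q x) \<le> q x"
    by (rule cINF_lower[OF bdd])
  \<comment> \<open>One inequality is enough: with \<open>inverse c\<close> at
    \<open>c *\<^sub>R x\<close> it becomes the reverse one. The same trick recurs for the
    functionals built below from infima and lower limits.\<close>
  have scale: "c * (INF q\<in>C. q x) \<le> (INF q\<in>C. q (c *\<^sub>R x))" if "c > 0" for c x
  proof (rule cINF_greatest[OF \<open>C \<noteq> {}\<close>])
    fix q assume "q \<in> C"
    then show "c * (INF q\<in>C. q x) \<le> q (c *\<^sub>R x)"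
      using low[of q x] that sub[of q] by (simp add: sublinear_scaleR_pos)
  qed
  show "sublinear (\<lambda>x. INF q\<in>C. q x)"
  proof (rule sublinearI)
    fix x y
    have "(INF q\<in>C. q (x + y)) \<le> q x + r y" if qr: "q \<in> C" "r \<in> C" for q r
    proof -
      obtain s where "s \<in> C" "\<And>x. s x \<le> q x" "\<And>x. s x \<le> r x"
        using chain[OF qr] qr by (metis order_refl)
      then show ?thesis
        using low[of s "x + y"] sublinear_add[OF sub, of s x y] by (smt (verit))
    qed
    then have "(INF q\<in>C. q (x + y)) - r y \<le> (INF q\<in>C. q x)" if "r \<in> C" for r
      using that by (intro cINF_greatest[OF \<open>C \<noteq> {}\<close>]) (simp add: diff_le_eq)
    then have "(INF q\<in>C. q (x + y)) - (INF q\<in>C. q x) \<le> (INF q\<in>C. q y)"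
      by (intro cINF_greatest[OF \<open>C \<noteq> {}\<close>]) (simp add: algebra_simps)
    then show "(INF q\<in>C. q (x + y)) \<le> (INF q\<in>C. q x) + (INF q\<in>C. q y)"
      by simp
  next
    fix c :: real and x assume c: "c > 0"
    have "(INF q\<in>C. q (c *\<^sub>R x)) \<le> c * (INF q\<in>C. q x)"
      using scale[of "inverse c" "c *\<^sub>R x"] c by (simp add: field_simps)
    with scale[OF c, of x] show "(INF q\<in>C. q (c *\<^sub>R x)) = c * (INF q\<in>C. q x)"
      by simp
  qed
qed

text \<open>\<open>r\<close> is the largest sublinear functional below \<open>p\<close> with value
  at most -(p y) at -y: such an s satisfies s x \<le> s (x + t y) + t s (-y) \<le> p (x + t y) - t p
  y. In the second claim, t = 0 gives r \<le> p, and t = 1 at x = -y gives the bound at -y.\<close>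

lemma sublinear_infimal_translate:
  fixes p :: "'a::real_vector \<Rightarrow> real" and y :: 'a
  assumes p: "sublinear p"
  defines "r \<equiv> \<lambda>x. INF t\<in>{0..}. p (x + t *\<^sub>R y) - t * p y"
  shows "sublinear r" and "\<And>x t. t \<ge> 0 \<Longrightarrow> r x \<le> p (x + t *\<^sub>R y) - t * p y"
proof -
  have bdd: "bdd_below ((\<lambda>t. p (x + t *\<^sub>R y) - t * p y) ` {0..})" for x
  proof (rule bdd_belowI2)
    fix t :: real assume "t \<in> {0..}"
    then show "- p (- x) \<le> p (x + t *\<^sub>R y) - t * p y"
      using sublinear_add[OF p, of "x + t *\<^sub>R y" "- x"] sublinear_scaleR[OF p, of t y] by simp
  qed
  have low: "r x \<le> p (x + t *\<^sub>R y) - t * p y" if "t \<ge> 0" for x t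
    unfolding r_def using that by (intro cINF_lower[OF bdd]) simp
  then show "\<And>x t. t \<ge> 0 \<Longrightarrow> r x \<le> p (x + t *\<^sub>R y) - t * p y" .
  have greatest: "c \<le> r x" if "\<And>t. t \<ge> 0 \<Longrightarrow> c \<le> p (x + t *\<^sub>R y) - t * p y" for c x
    unfolding r_def using that by (intro cINF_greatest) auto
  have scale: "c * r x \<le> r (c *\<^sub>R x)" if c: "c > 0" for c x
  proof (rule greatest)
    fix t :: real assume "t \<ge> 0"
    then have "c * r x \<le> c * (p (x + (t / c) *\<^sub>R y) - (t / c) * p y)"
      using c low[of "t / c" x] by simp
    also have "\<dots> = p (c *\<^sub>R (x + (t / c) *\<^sub>R y)) - t * p y"
      using c by (simp add: sublinear_scaleR_pos[OF p] right_diff_distrib)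
    also have "c *\<^sub>R (x + (t / c) *\<^sub>R y) = c *\<^sub>R x + t *\<^sub>R y"
      using c by (simp add: scaleR_right_distrib)
    finally show "c * r x \<le> p (c *\<^sub>R x + t *\<^sub>R y) - t * p y" .
  qed
  show "sublinear r"
  proof (rule sublinearI)
    fix x z
    have "r (x + z) \<le> (p (x + t *\<^sub>R y) - t * p y) + (p (z + s *\<^sub>R y) - s * p y)"
      if "t \<ge> 0" "s \<ge> 0" for t s
      using low[of "t + s" "x + z"] that sublinear_add[OF p, of "x + t *\<^sub>R y" "z + s *\<^sub>R y"]
      by (simp add: algebra_simps)
    then have "r (x + z) - (p (z + s *\<^sub>R y) - s * p y) \<le> r x" if "s \<ge> 0" for s
      using that by (intro greatest) (simp add: algebra_simps)
    then have "r (x + z) - r x \<le> r z"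
      by (intro greatest) (simp add: algebra_simps)
    then show "r (x + z) \<le> r x + r z" by simp
  next
    fix c :: real and x assume c: "c > 0"
    have "r (c *\<^sub>R x) \<le> c * r x"
      using scale[of "inverse c" "c *\<^sub>R x"] c by (simp add: field_simps)
    with scale[OF c, of x] show "r (c *\<^sub>R x) = c * r x" by simp
  qed
qed

lemma minimal_sublinear_exists:
  fixes p :: "'a::real_vector \<Rightarrow> real"
  assumes p: "sublinear p"
  obtains q where "sublinear q" "\<And>x. q x \<le> p x"
    "\<And>r. sublinear r \<Longrightarrow> (\<And>x. r x \<le> q x) \<Longrightarrow> r = q"
proof -
  define A where "A = {q. sublinear q \<and> (\<forall>x. q x \<le> p x)}"
  \<comment> \<open>Zorn's lemma delivers a maximal element, so the pointwise order is
    reversed.\<close>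
  define P :: "('a \<Rightarrow> real) \<Rightarrow> ('a \<Rightarrow> real) \<Rightarrow> bool" where "P = (\<lambda>q r. \<forall>x. r x \<le> q x)"
  have "\<exists>m\<in>A. \<forall>a\<in>A. P m a \<longrightarrow> a = m"
  proof (rule predicate_Zorn)
    show "partial_order_on A (relation_of P A)"
    proof (rule partial_order_on_relation_ofI)
      show "P q q" for q by (simp add: P_def)
      show "P q t" if "P q r" "P r t" for q r t using that by (auto simp: P_def intro: order_trans)
      show "q = r" if "P q r" "P r q" for q r using that by (auto simp: P_def fun_eq_iff intro: antisym)
    qed
  next
    fix C assume C: "C \<in> Chains (relation_of P A)"
    then have CA: "C \<subseteq> A"
      by (auto simp: Chains_def relation_of_def)
    have chain: "(\<forall>x. q x \<le> r x) \<or> (\<forall>x. r x \<le> q x)" if "q \<in> C" "r \<in> C" for q r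
      using C that by (auto simp: Chains_def relation_of_def P_def)
    show "\<exists>u\<in>A. \<forall>a\<in>C. P a u"
    proof (cases "C = {}")
      case True
      then show ?thesis using p by (auto simp: A_def)
    next
      case False
      have sub: "sublinear q" and le: "q x \<le> p x" if "q \<in> C" for q x
        using that CA by (auto simp: A_def)
      have inf: "sublinear (\<lambda>x. INF q\<in>C. q x)"
        by (rule sublinear_INF_chain(1)[of C p]) (use False sub le chain in auto)
      have low: "(INF q\<in>C. q x) \<le> q x" if "q \<in> C" for q x
        by (rule sublinear_INF_chain(2)[of C p]) (use False sub le chain that in auto)
      obtain q where q: "q \<in> C" using False by auto
      have "(INF q\<in>C. q x) \<le> p x" for x
        using low[OF q] le[OF q] by (meson order_trans)
      then show ?thesis
        using inf low by (intro bexI[of _ "\<lambda>x. INF q\<in>C. q x"]) (auto simp: A_def P_def)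
    qed
  qed
  then obtain q where q: "q \<in> A" "\<And>a. a \<in> A \<Longrightarrow> P q a \<Longrightarrow> a = q" by blast
  show thesis
  proof (rule that)
    show "sublinear q" "\<And>x. q x \<le> p x" using q(1) by (auto simp: A_def)
    fix r assume "sublinear r" "\<And>x. r x \<le> q x"
    moreover from this have "r \<in> A" using q(1) by (auto simp: A_def intro: order_trans)
    ultimately show "r = q" using q(2)[of r] by (simp add: P_def)
  qed
qed

text \<open>A minimal sublinear functional below \<open>p\<close> is linear: comparing it with its infimal
  translates gives additivity. No extension step is needed.\<close>

lemma sublinear_dominates_linear:
  fixes p :: "'a::real_vector \<Rightarrow> real"
  assumes p: "sublinear p"
  obtains f where "linear f" "\<And>x. f x \<le> p x"
proof -
  obtain q where q: "sublinear q" and le: "\<And>x. q x \<le> p x"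
    and minimal: "\<And>r. sublinear r \<Longrightarrow> (\<And>x. r x \<le> q x) \<Longrightarrow> r = q"
    using minimal_sublinear_exists[OF p] by blast
  have add: "q (x + y) = q x + q y" for x y
  proof -
    define r where "r = (\<lambda>x. INF t\<in>{0..}. q (x + t *\<^sub>R y) - t * q y)"
    have low: "r x \<le> q (x + t *\<^sub>R y) - t * q y" if "t \<ge> 0" for x t
      unfolding r_def using sublinear_infimal_translate(2)[OF q that] .
    \<comment> \<open>The case t = 0 gives r \<le> q, so minimality applies; t = 1 then reads q x
      \<le> q (x + y) - q y, the superadditive half.\<close>
    have "r = q"
      using low[of 0] sublinear_infimal_translate(1)[OF q, of y]
      by (intro minimal) (auto simp: r_def)
    then show ?thesis
      using low[of 1 x] sublinear_add[OF q, of x y] by simp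
  qed
  have neg: "q (- x) = - q x" for x
    using add[of x "- x"] sublinear_zero[OF q] by simp
  have "q (c *\<^sub>R x) = c * q x" for c x
  proof (cases "c \<ge> 0")
    case True
    then show ?thesis using sublinear_scaleR[OF q] by simp
  next
    case False
    then have "q ((- c) *\<^sub>R x) = (- c) * q x"
      by (intro sublinear_scaleR[OF q]) simp
    then show ?thesis using neg[of "c *\<^sub>R x"] by simp
  qed
  then have "linear q"
    using add by (intro linearI) simp_all
  then show thesis using that le by blast
qed

text \<open>The linear minorant is taken below the infimal translate in direction y instead of below
  \<open>p\<close>: t = 1 gives f (-y) \<le> -(p y), hence f y \<ge> p y. This replaces the usual
  extension from the line through y.\<close>

theorem sublinear_supporting_linear:
  fixes p :: "'a::real_vector \<Rightarrow> real"
  assumes p: "sublinear p"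
  obtains f where "linear f" "\<And>x. f x \<le> p x" "f y = p y"
proof -
  define r where "r = (\<lambda>x. INF t\<in>{0..}. p (x + t *\<^sub>R y) - t * p y)"
  have low: "r x \<le> p (x + t *\<^sub>R y) - t * p y" if "t \<ge> 0" for x t
    unfolding r_def using sublinear_infimal_translate(2)[OF p that] .
  have "sublinear r"
    unfolding r_def by (rule sublinear_infimal_translate(1)[OF p])
  then obtain f where f: "linear f" "\<And>x. f x \<le> r x"
    using sublinear_dominates_linear by blast
  have le: "f x \<le> p x" for x
    using f(2)[of x] low[of 0 x] by simp
  have "f (- y) \<le> - p y"
    using f(2)[of "- y"] low[of 1 "- y"] sublinear_zero[OF p] by simp
  then have "f y = p y"
    using le[of y] by (simp add: linear_neg[OF f(1)])
  then show thesis using that f(1) le by blast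
qed

text \<open>The distance to \<open>R\<close> is sublinear and dominated by the norm, vanishes on
  \<open>R\<close> and is positive at a point y outside. A linear functional below it that touches
  it at y is therefore bounded and nonzero, and on \<open>R\<close> both f w and f (-w) are at most
  0.\<close>

corollary closed_subspace_annihilator:
  fixes R :: "'b::real_normed_vector set"
  assumes R: "closed R" "subspace R" "R \<noteq> UNIV"
  obtains g :: "'b \<Rightarrow>\<^sub>L real" where "g \<noteq> 0" "\<And>w. w \<in> R \<Longrightarrow> blinfun_apply g w = 0"
proof -
  obtain y where y: "y \<notin> R" using R(3) by auto
  have R0: "0 \<in> R" using R(2) by (rule subspace_0)
  then have ne: "R \<noteq> {}" by auto
  have approx: "\<exists>a\<in>R. dist x a < infdist x R + e" if "e > 0" for x e
    using cInf_lessD[of "dist x ` R" "infdist x R + e"] that ne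
    by (auto simp: infdist_notempty)
  have scale: "infdist (c *\<^sub>R x) R \<le> c * infdist x R" if c: "c > 0" for c x
  proof (rule field_le_epsilon)
    fix e :: real assume "e > 0"
    then obtain a where a: "a \<in> R" "dist x a < infdist x R + e / c"
      using approx[of "e / c" x] c by auto
    have "infdist (c *\<^sub>R x) R \<le> dist (c *\<^sub>R x) (c *\<^sub>R a)"
      using a R(2) by (intro infdist_le) (simp add: subspace_scale)
    also have "\<dots> = c * dist x a"
      using c by (simp add: dist_norm flip: scaleR_diff_right)
    also have "\<dots> \<le> c * (infdist x R + e / c)"
      using a(2) c by simp
    also have "\<dots> = c * infdist x R + e"
      using c by (simp add: field_simps)
    finally show "infdist (c *\<^sub>R x) R \<le> c * infdist x R + e" .
  qed
  have "sublinear (\<lambda>x. infdist x R)"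
  proof (rule sublinearI)
    fix u v
    show "infdist (u + v) R \<le> infdist u R + infdist v R"
    proof (rule field_le_epsilon)
      fix e :: real assume "e > 0"
      then obtain a b where ab: "a \<in> R" "dist u a < infdist u R + e / 2"
        "b \<in> R" "dist v b < infdist v R + e / 2"
        using approx[of "e / 2"] by (meson half_gt_zero)
      have "infdist (u + v) R \<le> dist (u + v) (a + b)"
        using ab R(2) by (intro infdist_le) (simp add: subspace_add)
      also have "\<dots> \<le> dist u a + dist v b"
        by (rule dist_triangle_add)
      finally show "infdist (u + v) R \<le> infdist u R + infdist v R + e"
        using ab by linarith
    qed
  next
    fix c :: real and x assume c: "c > 0"
    have "c * infdist x R \<le> infdist (c *\<^sub>R x) R"
      using scale[of "inverse c" "c *\<^sub>R x"] c by (simp add: field_simps)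
    with scale[OF c, of x] show "infdist (c *\<^sub>R x) R = c * infdist x R" by simp
  qed
  then obtain f where f: "linear f" "\<And>x. f x \<le> infdist x R" "f y = infdist y R"
    using sublinear_supporting_linear by blast
  have le_norm: "infdist x R \<le> norm x" for x
    using infdist_le[OF R0, of x] by simp
  have "norm (f x) \<le> norm x * 1" for x
    using f(2)[of x] f(2)[of "- x"] le_norm[of x] le_norm[of "- x"] linear_neg[OF f(1), of x]
    by (simp add: abs_le_iff)
  then have bl: "bounded_linear f"
    using f(1) by (intro bounded_linear_intro[where K = 1]) (auto simp: linear_add linear_scale)
  have app: "blinfun_apply (Blinfun f) = f"
    using bl by (rule bounded_linear_Blinfun_apply)
  show thesis
  proof (rule that)
    have "infdist y R > 0"
      using R(1) ne y by (rule infdist_pos_not_in_closed)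
    then show "Blinfun f \<noteq> 0"
      using f(3) app by (metis less_irrefl zero_blinfun.rep_eq)
    fix w assume w: "w \<in> R"
    then have "- w \<in> R" using R(2) by (rule subspace_neg[rotated])
    then show "blinfun_apply (Blinfun f) w = 0"
      using w f(2)[of w] f(2)[of "- w"] linear_neg[OF f(1), of w] by (simp add: app)
  qed
qed

section \<open>An alternative theorem for sublinear functionals\<close>

text \<open>Outside the trivial cases take a = 1. A weight b \<ge> 0 works when -g v / h v \<le> b
  for all v with g v < 0 (where h v > 0) and b \<le> g u / (-h u) for all u with h u < 0. If some
  lower bound exceeded some upper bound, a suitable v + s u would make both functionals
  negative.\<close>

lemma sublinear_alternative_two:
  fixes g h :: "'a::real_vector \<Rightarrow> real"
  assumes g: "sublinear g" and h: "sublinear h"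
    and add: "\<And>u v. u \<in> K \<Longrightarrow> v \<in> K \<Longrightarrow> u + v \<in> K"
    and scale: "\<And>c u. c > 0 \<Longrightarrow> u \<in> K \<Longrightarrow> c *\<^sub>R u \<in> K"
    and none: "\<not> (\<exists>u\<in>K. g u < 0 \<and> h u < 0)"
  shows "\<exists>a b. a \<ge> 0 \<and> b \<ge> 0 \<and> (a \<noteq> 0 \<or> b \<noteq> 0) \<and> (\<forall>u\<in>K. a * g u + b * h u \<ge> 0)"
proof (cases "(\<forall>u\<in>K. g u \<ge> 0) \<or> (\<forall>u\<in>K. h u \<ge> 0)")
  case True
  then show ?thesis
  proof
    assume "\<forall>u\<in>K. g u \<ge> 0"
    then show ?thesis by (intro exI[of _ 1] exI[of _ 0]) simp
  next
    assume "\<forall>u\<in>K. h u \<ge> 0"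
    then show ?thesis by (intro exI[of _ 0] exI[of _ 1]) simp
  qed
next
  case False
  then obtain u0 v0 where u0: "u0 \<in> K" "h u0 < 0" and v0: "v0 \<in> K" "g v0 < 0"
    by (meson not_le)
  have comb: "\<not> (g v + s * g u < 0 \<and> h v + s * h u < 0)"
    if "u \<in> K" "v \<in> K" "s > 0" for u v s
  proof
    assume "g v + s * g u < 0 \<and> h v + s * h u < 0"
    then have "g (v + s *\<^sub>R u) < 0" "h (v + s *\<^sub>R u) < 0"
      using sublinear_add[OF g, of v "s *\<^sub>R u"] sublinear_add[OF h, of v "s *\<^sub>R u"] \<open>s > 0\<close>
      by (auto simp: sublinear_scaleR_pos[OF g] sublinear_scaleR_pos[OF h])
    then show False using none add[OF that(2) scale[OF that(3) that(1)]] by blast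
  qed
  have hpos: "h v > 0" if v: "v \<in> K" "g v < 0" for v
  proof (rule ccontr)
    assume "\<not> h v > 0"
    \<comment> \<open>This size gives s * g u0 \<le> -g v / 2, so adding s u0 keeps g negative while
      it pushes h below 0; the + 1 guards against g u0 = 0.\<close>
    define s where "s = - g v / (2 * (\<bar>g u0\<bar> + 1))"
    have s: "s > 0" using v by (simp add: s_def divide_neg_pos)
    have "s * g u0 \<le> s * (\<bar>g u0\<bar> + 1)"
      using s by (intro mult_left_mono) auto
    also have "\<dots> = - g v / 2" by (simp add: s_def field_simps)
    finally have "g v + s * g u0 < 0" using v by linarith
    moreover have "h v + s * h u0 < 0"
      using \<open>\<not> h v > 0\<close> mult_pos_neg[OF s u0(2)] by linarith
    ultimately show False using comb[OF u0(1) v(1) s] by blast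
  qed
  have ratio: "- g v / h v \<le> g u / - h u"
    if u: "u \<in> K" "h u < 0" and v: "v \<in> K" "g v < 0" for u v
  proof (rule ccontr)
    assume less: "\<not> ?thesis"
    note hv = hpos[OF v]
    have gu: "g u \<ge> 0" using none u by force
    have *: "g u * h v < g v * h u"
      using less hv u(2) by (simp add: field_simps)
    \<comment> \<open>The condition on s is h v / (-h u) < s < -g v / g u. The failed ratio bound
      makes this interval nonempty; for g u = 0 its upper end disappears.\<close>
    have "\<exists>s>0. s * g u < - g v \<and> h v < s * - h u"
    proof (cases "g u = 0")
      case True
      then show ?thesis
        using v u hv by (intro exI[of _ "h v / - h u + 1"]) (auto simp: field_simps mult_neg_neg divide_pos_neg)
    next
      case False
      then have "h v / - h u < - g v / g u"
        using gu * u(2) by (simp add: field_simps)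
      then obtain s where "h v / - h u < s" "s < - g v / g u"
        using dense by blast
      moreover have "h v / - h u > 0" using hv u(2) by (simp add: divide_pos_neg)
      ultimately show ?thesis
        using False gu u(2)
        by (intro exI[of _ s] conjI) (linarith, simp_all add: field_simps)
    qed
    then obtain s where "s > 0" "g v + s * g u < 0" "h v + s * h u < 0"
      by (auto simp: algebra_simps)
    then show False using comb[OF u(1) v(1)] by blast
  qed
  \<comment> \<open>The least admissible weight: \<open>v0\<close> makes the set nonempty and
    \<open>u0\<close> bounds it.\<close>
  define b where "b = (SUP v\<in>{v\<in>K. g v < 0}. - g v / h v)"
  have bdd: "bdd_above ((\<lambda>v. - g v / h v) ` {v\<in>K. g v < 0})"
    using ratio[OF u0] by (intro bdd_aboveI2[where M = "g u0 / - h u0"]) auto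
  have b1: "- g v / h v \<le> b" if "v \<in> K" "g v < 0" for v
    unfolding b_def using that by (intro cSUP_upper[OF _ bdd]) simp
  have b2: "b \<le> g u / - h u" if "u \<in> K" "h u < 0" for u
    unfolding b_def using v0 ratio[OF that] by (intro cSUP_least) auto
  have b0: "b \<ge> 0"
    using b1[OF v0] hpos[OF v0] v0(2) by (smt (verit) divide_nonneg_pos)
  have "g u + b * h u \<ge> 0" if u: "u \<in> K" for u
  proof -
    consider "g u < 0" | "h u < 0" | "g u \<ge> 0" "h u \<ge> 0" by linarith
    then show ?thesis
    proof cases
      case 1
      then show ?thesis using b1[OF u] hpos[OF u] by (simp add: field_simps)
    next
      case 2
      then show ?thesis using b2[OF u] by (simp add: field_simps)
    next
      case 3
      then show ?thesis using b0 by simp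
    qed
  qed
  then show ?thesis using b0 by (intro exI[of _ 1] exI[of _ b]) simp
qed

text \<open>The cone \<open>K\<close> is generalised in the induction: on the part of
  \<open>K\<close> where g i < 0 the remaining functionals are never all negative, so they have a
  combination that is nonnegative there. That combination and g i are then never both negative on
  \<open>K\<close>, and the case of two functionals applies.\<close>

lemma sublinear_alternative:
  fixes g :: "'i \<Rightarrow> 'a::real_vector \<Rightarrow> real"
  assumes "finite J" "J \<noteq> {}" and "\<And>i. i \<in> J \<Longrightarrow> sublinear (g i)"
    and "\<And>u v. u \<in> K \<Longrightarrow> v \<in> K \<Longrightarrow> u + v \<in> K"
    and "\<And>c u. c > 0 \<Longrightarrow> u \<in> K \<Longrightarrow> c *\<^sub>R u \<in> K"
    and "\<not> (\<exists>u\<in>K. \<forall>i\<in>J. g i u < 0)"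
  shows "\<exists>l. (\<forall>i\<in>J. l i \<ge> (0::real)) \<and> (\<exists>i\<in>J. l i \<noteq> 0) \<and> (\<forall>u\<in>K. (\<Sum>i\<in>J. l i * g i u) \<ge> 0)"
  using assms
proof (induction J arbitrary: K rule: finite_ne_induct)
  case (singleton i)
  then show ?case by (intro exI[of _ "\<lambda>_. 1"]) (auto simp: not_less)
next
  case (insert i J)
  have gi: "sublinear (g i)" using insert.prems by simp
  \<comment> \<open>This subcone never contains 0 and may be empty, which is why \<open>K\<close> is
    only asked to be closed under sums and positive multiples.\<close>
  let ?C = "{u\<in>K. g i u < 0}"
  have "\<exists>l. (\<forall>j\<in>J. l j \<ge> 0) \<and> (\<exists>j\<in>J. l j \<noteq> 0) \<and> (\<forall>u\<in>?C. (\<Sum>j\<in>J. l j * g j u) \<ge> 0)"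
  proof (rule insert.IH)
    show "u + v \<in> ?C" if "u \<in> ?C" "v \<in> ?C" for u v
      using that insert.prems(2) sublinear_add[OF gi, of u v] by force
    show "c *\<^sub>R u \<in> ?C" if "c > 0" "u \<in> ?C" for c u
      using that insert.prems(3) by (auto simp: sublinear_scaleR_pos[OF gi] mult_pos_neg)
  qed (use insert.prems in auto)
  then obtain l where l: "\<And>j. j \<in> J \<Longrightarrow> l j \<ge> 0" "\<exists>j\<in>J. l j \<noteq> 0"
    "\<And>u. u \<in> K \<Longrightarrow> g i u < 0 \<Longrightarrow> (\<Sum>j\<in>J. l j * g j u) \<ge> 0"
    by auto
  have sub: "sublinear (\<lambda>u. \<Sum>j\<in>J. l j * g j u)"
    using insert.prems l(1) by (intro sublinear_sum) auto
  have none: "\<not> (\<exists>u\<in>K. g i u < 0 \<and> (\<Sum>j\<in>J. l j * g j u) < 0)"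
    using l(3) by force
  obtain a b where ab: "a \<ge> 0" "b \<ge> 0" "a \<noteq> 0 \<or> b \<noteq> 0"
    "\<And>u. u \<in> K \<Longrightarrow> a * g i u + b * (\<Sum>j\<in>J. l j * g j u) \<ge> 0"
    using sublinear_alternative_two[OF gi sub insert.prems(2,3) none] by blast
  define l' where "l' = (\<lambda>j. if j = i then a else b * l j)"
  have "(\<Sum>j\<in>insert i J. l' j * g j u) = a * g i u + b * (\<Sum>j\<in>J. l j * g j u)" for u
  proof -
    have "(\<Sum>j\<in>J. l' j * g j u) = (\<Sum>j\<in>J. b * (l j * g j u))"
      using insert.hyps by (intro sum.cong) (auto simp: l'_def)
    then show ?thesis
      using insert.hyps by (simp add: l'_def sum_distrib_left)
  qed
  moreover have "\<exists>j\<in>insert i J. l' j \<noteq> 0"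
    using ab(3) l(2) insert.hyps by (auto simp: l'_def)
  moreover have "\<forall>j\<in>insert i J. l' j \<ge> 0"
    using ab l(1) by (auto simp: l'_def)
  ultimately show ?case using ab(4) by (intro exI[of _ l']) simp
qed

section \<open>Bounded right inverses of surjections\<close>

text \<open>The Baire half of the open mapping theorem: the closures of the images of the bounded
  pieces of \<open>S\<close> cover the complete codomain, so one of them contains a ball about some
  y. Subtracting approximate preimages of y + c w and of y handles w. Because of the closures the
  preimages are only approximate.\<close>

lemma approx_preimage_bounded:
  fixes A :: "'a::real_normed_vector \<Rightarrow> 'b::banach"
  assumes A: "bounded_linear A" and S: "subspace S" and onto: "A ` S = UNIV"
  obtains M where "M > 0"
    "\<And>w e. e > 0 \<Longrightarrow> \<exists>u\<in>S. norm u \<le> M * norm w \<and> norm (w - A u) \<le> e * norm w"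
proof -
  interpret A: bounded_linear A by fact
  define F where "F = (\<lambda>n::nat. closure (A ` (S \<inter> cball 0 (real n))))"
  have "\<Union>(range F) = UNIV"
  proof (intro equalityI subset_UNIV subsetI)
    fix w
    obtain u where u: "u \<in> S" "w = A u" using onto by blast
    obtain n where "norm u \<le> real n" using real_arch_simple by blast
    then have "w \<in> A ` (S \<inter> cball 0 (real n))" using u by (intro image_eqI[of _ _ u]) auto
    then have "w \<in> F n" unfolding F_def by (rule subsetD[OF closure_subset])
    then show "w \<in> \<Union>(range F)" by blast
  qed
  moreover have "interior (\<Union>(range F)) = {}" if "\<And>n. interior (F n) = {}"
  proof -
    have "euclidean interior_of \<Union>(range F) = {}"
    proof (rule Baire_category_alt)
      show "completely_metrizable_space (euclidean :: 'b topology) \<or>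
        locally_compact_space (euclidean :: 'b topology) \<and> regular_space (euclidean :: 'b topology)"
        by (simp add: completely_metrizable_space_euclidean)
      show "closedin euclidean T \<and> euclidean interior_of T = {}" if "T \<in> range F" for T
        using that \<open>\<And>n. interior (F n) = {}\<close>
        by (auto simp: F_def euclidean_interior_of simp flip: closed_closedin)
    qed simp
    then show ?thesis by (simp add: euclidean_interior_of)
  qed
  ultimately obtain n where "interior (F n) \<noteq> {}"
    by (metis interior_UNIV UNIV_not_empty)
  then obtain y r where r: "r > 0" "cball y r \<subseteq> F n"
    by (meson equals0I mem_interior_cball)
  have approx: "\<exists>u\<in>S. norm u \<le> n \<and> dist (A u) z < d" if "z \<in> F n" "d > 0" for z d
    using that by (fastforce simp: F_def closure_approachable)
  have "\<exists>u\<in>S. norm u \<le> 2 * (n + 1) / r * norm w \<and> norm (w - A u) \<le> e * norm w"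
    if e: "e > 0" for w and e :: real
  proof (cases "w = 0")
    case True
    then show ?thesis using S by (intro bexI[of _ 0]) (auto simp: A.zero subspace_0)
  next
    case False
    \<comment> \<open>\<open>c\<close> stretches w to length r, so that y + c w stays in the ball.
      The difference u - v has norm at most 2 n; n + 1 in the final constant keeps it positive for n
      = 0.\<close>
    define c where "c = r / norm w"
    have c: "c > 0" using False r by (simp add: c_def)
    \<comment> \<open>Two errors below \<open>d\<close> add up to at most e * r, and division by
      \<open>c\<close> turns this into e * norm w.\<close>
    define d where "d = e * r / 2"
    have d: "d > 0" using e r by (simp add: d_def)
    have "y + c *\<^sub>R w \<in> F n" "y \<in> F n"
      using r False by (auto simp: c_def dist_norm intro!: subsetD[OF r(2)])
    then obtain u v where u: "u \<in> S" "norm u \<le> n" "dist (A u) (y + c *\<^sub>R w) < d"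
      and v: "v \<in> S" "norm v \<le> n" "dist (A v) y < d"
      using approx d by meson
    define x where "x = (1 / c) *\<^sub>R (u - v)"
    have "c *\<^sub>R (w - A x) = - ((A u - (y + c *\<^sub>R w)) - (A v - y))"
      using c by (simp add: x_def A.diff A.scaleR algebra_simps)
    then have "c * norm (w - A x) = norm ((A u - (y + c *\<^sub>R w)) - (A v - y))"
      using c by (metis abs_of_pos norm_minus_cancel norm_scaleR)
    also have "\<dots> \<le> norm (A u - (y + c *\<^sub>R w)) + norm (A v - y)"
      by (rule norm_triangle_ineq4)
    also have "\<dots> \<le> e * r"
      using u v by (simp add: dist_norm d_def)
    finally have "norm (w - A x) \<le> e * r / c" using c by (simp add: field_simps)
    also have "e * r / c = e * norm w" using r False by (simp add: c_def)
    finally have 1: "norm (w - A x) \<le> e * norm w" .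
    have "norm x = norm (u - v) / c" using c by (simp add: x_def)
    also have "\<dots> \<le> (2 * (n + 1)) / c"
      using c u v norm_triangle_ineq4[of u v] by (intro divide_right_mono) auto
    also have "\<dots> = 2 * (n + 1) / r * norm w" using r False by (simp add: c_def)
    finally have "norm x \<le> 2 * (n + 1) / r * norm w" .
    moreover have "x \<in> S" unfolding x_def using S u v by (simp add: subspace_diff subspace_scale)
    ultimately show ?thesis using 1 by blast
  qed
  then show thesis using r by (intro that[of "2 * (n + 1) / r"]) (auto simp: add_pos_nonneg)
qed

text \<open>Each correction halves the residual, so the corrections are dominated by a geometric
  series and sum up in the complete domain, inside the closed \<open>S\<close>. The sum of that
  series is the factor 2 in 2 * M.\<close>

theorem open_mapping_bounded_preimage:
  fixes A :: "'a::banach \<Rightarrow> 'b::banach"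
  assumes A: "bounded_linear A" and S: "subspace S" "closed S" and onto: "A ` S = UNIV"
  obtains M where "M > 0" "\<And>w. \<exists>u\<in>S. A u = w \<and> norm u \<le> M * norm w"
proof -
  interpret A: bounded_linear A by fact
  obtain M where M: "M > 0"
    "\<And>w e. e > 0 \<Longrightarrow> \<exists>u\<in>S. norm u \<le> M * norm w \<and> norm (w - A u) \<le> e * norm w"
    using approx_preimage_bounded[OF A S(1) onto] by blast
  have "\<forall>w. \<exists>u. u \<in> S \<and> norm u \<le> M * norm w \<and> norm (w - A u) \<le> (1/2) * norm w"
    using M(2)[of "1/2"] by auto
  then obtain g where g: "\<And>w. g w \<in> S" "\<And>w. norm (g w) \<le> M * norm w"
    "\<And>w. norm (w - A (g w)) \<le> (1/2) * norm w"
    by metis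
  have "\<exists>u\<in>S. A u = w \<and> norm u \<le> 2 * M * norm w" for w
  proof -
    \<comment> \<open>\<open>s k\<close> is the residual of w after k corrections.\<close>
    define s where "s = rec_nat w (\<lambda>_ z. z - A (g z))"
    have s0: "s 0 = w" and sS: "s (Suc k) = s k - A (g (s k))" for k
      by (simp_all add: s_def)
    have s_le: "norm (s k) \<le> (1/2) ^ k * norm w" for k
    proof (induction k)
      case (Suc k)
      then show ?case using g(3)[of "s k"] by (simp add: sS)
    qed (simp add: s0)
    have g_le: "norm (g (s k)) \<le> M * norm w * (1/2) ^ k" for k
      using order_trans[OF g(2) mult_left_mono[OF s_le[of k], of M]] M(1) by (simp add: mult.assoc mult.commute)
    have sums: "(\<lambda>k. M * norm w * (1/2) ^ k) sums (M * norm w * 2)"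
      using sums_mult[OF geometric_sums[of "1/2::real"], of "M * norm w"] by simp
    have "summable (\<lambda>k. norm (g (s k)))"
      using g_le by (intro summable_comparison_test'[OF sums_summable[OF sums], of 0]) simp
    then have summ: "summable (\<lambda>k. g (s k))" by (rule summable_norm_cancel)
    define u where "u = (\<Sum>k. g (s k))"
    have lim: "(\<lambda>n. \<Sum>k<n. g (s k)) \<longlonglongrightarrow> u"
      unfolding u_def using summ by (rule summable_LIMSEQ)
    have "u \<in> S"
      by (rule closed_sequentially[OF S(2) _ lim]) (simp add: g S(1) subspace_sum)
    moreover have "A u = w"
    proof -
      have "A (\<Sum>k<n. g (s k)) = w - s n" for n
        by (induction n) (simp_all add: s0 sS A.zero A.add)
      then have "(\<lambda>n. w - s n) \<longlonglongrightarrow> A u"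
        using A.tendsto[OF lim] by simp
      moreover have "s \<longlonglongrightarrow> 0"
      proof (rule Lim_null_comparison)
        show "\<forall>\<^sub>F k in sequentially. norm (s k) \<le> (1/2) ^ k * norm w" using s_le by simp
        show "(\<lambda>k. (1/2) ^ k * norm w) \<longlonglongrightarrow> 0"
          by (intro tendsto_mult_left_zero LIMSEQ_power_zero) simp
      qed
      ultimately show ?thesis
        using tendsto_diff[of "\<lambda>_. w" w sequentially s 0] LIMSEQ_unique by fastforce
    qed
    moreover have "norm u \<le> 2 * M * norm w"
    proof -
      have "norm u \<le> (\<Sum>k. M * norm w * (1/2) ^ k)"
        unfolding u_def using g_le sums_summable[OF sums] by (rule norm_suminf_le)
      then show ?thesis using sums_unique[OF sums] by (simp add: mult_ac)
    qed
    ultimately show ?thesis by blast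
  qed
  then show thesis using M(1) by (intro that[of "2 * M"]) auto
qed

lemma bounded_right_inverse:
  fixes A :: "'a::banach \<Rightarrow> 'b::banach"
  assumes A: "bounded_linear A" "surj A" and S: "subspace S" "closed S"
    and meet: "{u. A u = 0} \<inter> S = {0}"
    and span: "\<And>x. \<exists>k e. A k = 0 \<and> e \<in> S \<and> x = k + e"
  obtains T where "bounded_linear T" "\<And>w. A (T w) = w"
proof -
  interpret A: bounded_linear A by fact
  have "A ` S = UNIV"
  proof (intro equalityI subset_UNIV subsetI)
    fix w
    obtain x where x: "w = A x" using A(2) by (metis surjD)
    obtain k e where "A k = 0" "e \<in> S" "x = k + e" using span by blast
    then have "w = A e" using x by (simp add: A.add)
    then show "w \<in> A ` S" using \<open>e \<in> S\<close> by blast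
  qed
  then obtain M where "\<And>w. \<exists>u\<in>S. A u = w \<and> norm u \<le> M * norm w"
    using open_mapping_bounded_preimage[OF A(1) S] by blast
  then obtain T where T: "\<And>w. T w \<in> S" "\<And>w. A (T w) = w" "\<And>w. norm (T w) \<le> M * norm w"
    by metis
  have inj: "u = v" if "u \<in> S" "v \<in> S" "A u = A v" for u v
  proof -
    have "u - v \<in> {u. A u = 0} \<inter> S" using that S(1) by (simp add: A.diff subspace_diff)
    then show ?thesis using meet by simp
  qed
  have "bounded_linear T"
  proof (rule bounded_linear_intro[where K = M])
    show "T (x + y) = T x + T y" for x y
      by (rule inj) (simp_all add: T S(1) subspace_add A.add)
    show "T (c *\<^sub>R x) = c *\<^sub>R T x" for c x
      by (rule inj) (simp_all add: T S(1) subspace_scale A.scaleR)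
    show "norm (T x) \<le> norm x * M" for x
      using T(3)[of x] by (simp add: mult.commute)
  qed
  then show thesis using that T(2) by blast
qed

section \<open>Lyusternik's theorem\<close>

text \<open>Uniformity in r matters because the later corrections depend on t; e = 0 covers the
  unperturbed ray.\<close>

lemma eventually_ray_in_open:
  fixes x :: "'a::real_normed_vector"
  assumes "open V" "x \<in> V"
  shows "\<forall>\<^sub>F t in at_right 0. \<forall>r. norm r \<le> e * t \<longrightarrow> x + t *\<^sub>R u + r \<in> V"
proof -
  obtain d where d: "d > 0" "ball x d \<subseteq> V"
    using assms open_contains_ball by blast
  have "((\<lambda>t. t * (norm u + \<bar>e\<bar>)) \<longlongrightarrow> 0 * (norm u + \<bar>e\<bar>)) (at_right 0)"
    by (intro tendsto_intros)
  then have "\<forall>\<^sub>F t in at_right 0. t * (norm u + \<bar>e\<bar>) < d"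
    using d(1) by (intro order_tendstoD(2)) auto
  moreover have "\<forall>\<^sub>F t in at_right (0::real). t > 0"
    by (rule eventually_at_right_less)
  ultimately show ?thesis
  proof eventually_elim
    case (elim t)
    have "x + t *\<^sub>R u + r \<in> V" if r: "norm r \<le> e * t" for r
    proof -
      have "norm (t *\<^sub>R u + r) \<le> t * norm u + \<bar>e\<bar> * t"
      proof -
        have "e * t \<le> \<bar>e\<bar> * t" using elim by (intro mult_right_mono) auto
        moreover have "norm (t *\<^sub>R u) = t * norm u" using elim by simp
        ultimately show ?thesis using norm_triangle_ineq[of "t *\<^sub>R u" r] r by linarith
      qed
      then have "norm (t *\<^sub>R u + r) < d" using elim by (simp add: algebra_simps)
      moreover have "dist x (x + t *\<^sub>R u + r) = norm (t *\<^sub>R u + r)"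
        by (metis add.assoc add_diff_cancel_left' dist_commute dist_norm)
      ultimately show ?thesis using d(2) by auto
    qed
    then show ?case by blast
  qed
qed

text \<open>The mean value inequality on a ball where h' stays within e of h' x. Both points vary,
  as a contraction estimate requires; differentiability at x alone would only compare with
  x.\<close>

lemma strict_derivative_bound:
  fixes h :: "'a::real_normed_vector \<Rightarrow> 'b::real_normed_vector"
    and h' :: "'a \<Rightarrow> 'a \<Rightarrow>\<^sub>L 'b"
  assumes U: "open U" "x \<in> U"
    and der: "\<And>y. y \<in> U \<Longrightarrow> (h has_derivative blinfun_apply (h' y)) (at y)"
    and cont: "isCont h' x" and "e > 0"
  obtains d where "d > 0" "ball x d \<subseteq> U"
    "\<And>y z. y \<in> ball x d \<Longrightarrow> z \<in> ball x d \<Longrightarrow> norm (h z - h y - h' x (z - y)) \<le> norm (z - y) * e"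
proof -
  obtain d1 where d1: "d1 > 0" "ball x d1 \<subseteq> U"
    using U open_contains_ball by blast
  obtain d2 where d2: "d2 > 0" "\<And>y. dist y x < d2 \<Longrightarrow> dist (h' y) (h' x) < e"
    using cont \<open>e > 0\<close> unfolding continuous_at_eps_delta by blast
  define d where "d = min d1 d2"
  show thesis
  proof (rule that[of d])
    show "d > 0" "ball x d \<subseteq> U" using d1 d2 by (auto simp: d_def)
    fix y z assume yz: "y \<in> ball x d" "z \<in> ball x d"
    show "norm (h z - h y - h' x (z - y)) \<le> norm (z - y) * e"
    proof (rule differentiable_bound_linearization[where S = "ball x d" and ?x0.0 = x
          and f' = "\<lambda>v. blinfun_apply (h' v)"])
      show "y + t *\<^sub>R (z - y) \<in> ball x d" if "t \<in> {0..1}" for t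
      proof -
        have "(1 - t) *\<^sub>R y + t *\<^sub>R z \<in> ball x d"
          using convexD_alt[OF convex_ball yz] that by simp
        then show ?thesis by (simp add: algebra_simps)
      qed
      show "(h has_derivative blinfun_apply (h' v)) (at v within ball x d)" if "v \<in> ball x d" for v
        by (rule has_derivative_at_withinI[OF der]) (use that \<open>ball x d \<subseteq> U\<close> in auto)
      show "onorm (blinfun_apply (h' v) - blinfun_apply (h' x)) \<le> e" if "v \<in> ball x d" for v
      proof -
        have "norm (h' v - h' x) \<le> e"
          using d2(2)[of v] that by (simp add: d_def dist_commute dist_norm less_imp_le)
        then show ?thesis by (simp add: norm_blinfun.rep_eq minus_blinfun.rep_eq fun_diff_def)
      qed
      show "x \<in> ball x d" using \<open>d > 0\<close> by simp
    qed
  qed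
qed

text \<open>Lyusternik: along a kernel direction \<open>u\<close> the equation \<open>h = 0\<close> is solved by a correction
  \<open>T w\<close> of size \<open>o(t)\<close>, where \<open>w\<close> is the fixed point of the contraction
  \<open>w \<mapsto> w - h (x + t u + T w)\<close>.\<close>

lemma kernel_direction_tangent:
  fixes h :: "'a::banach \<Rightarrow> 'b::banach" and h' :: "'a \<Rightarrow> 'a \<Rightarrow>\<^sub>L 'b"
  assumes U: "open U" "x \<in> U"
    and der: "\<And>y. y \<in> U \<Longrightarrow> (h has_derivative blinfun_apply (h' y)) (at y)"
    and cont: "isCont h' x"
    and T: "bounded_linear T" "\<And>w. h' x (T w) = w"
    and hx: "h x = 0" and u: "h' x u = 0" and e: "e > 0"
  shows "\<forall>\<^sub>F t in at_right 0. \<exists>r. norm r \<le> e * t \<and> h (x + t *\<^sub>R u + r) = 0"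
proof -
  interpret T: bounded_linear T by fact
  obtain K where K: "K > 0" "\<And>w. norm (T w) \<le> norm w * K"
    using T.pos_bounded by blast
  \<comment> \<open>With norm (T w) \<le> K * norm w this error rate gives the contraction factor K
    * k = 1/2.\<close>
  define k where "k = 1 / (2 * K)"
  have k: "k > 0" using K(1) by (simp add: k_def)
  obtain d where d: "d > 0"
    "\<And>y z. y \<in> ball x d \<Longrightarrow> z \<in> ball x d \<Longrightarrow>
      norm (h z - h y - h' x (z - y)) \<le> norm (z - y) * k"
    using strict_derivative_bound[OF U der cont k] by metis
  \<comment> \<open>Chosen so that norm (h (x + t u)) \<le> e * t / (2 * K), which puts the
    correction within e * t; the + 1 avoids dividing by 0 when u = 0.\<close>
  define k' where "k' = e / (2 * K * (norm u + 1))"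
  have "k' > 0"
    unfolding k'_def using K(1) e by (intro divide_pos_pos mult_pos_pos) (auto simp: add_nonneg_pos)
  then obtain d' where d': "d' > 0"
    "\<And>y z. y \<in> ball x d' \<Longrightarrow> z \<in> ball x d' \<Longrightarrow>
      norm (h z - h y - h' x (z - y)) \<le> norm (z - y) * k'"
    using strict_derivative_bound[OF U der cont] by metis
  have "\<forall>\<^sub>F t in at_right 0. \<forall>r. norm r \<le> e * t \<longrightarrow> x + t *\<^sub>R u + r \<in> ball x d"
    "\<forall>\<^sub>F t in at_right 0. \<forall>r. norm r \<le> 0 * t \<longrightarrow> x + t *\<^sub>R u + r \<in> ball x d'"
    using d d' by (intro eventually_ray_in_open; simp)+
  moreover have "\<forall>\<^sub>F t in at_right (0::real). t > 0"
    by (rule eventually_at_right_less)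
  ultimately show ?thesis
  proof eventually_elim
    case (elim t)
    define x' where "x' = x + t *\<^sub>R u"
    have "x' \<in> ball x d'" using elim(2) by (simp add: x'_def)
    then have "norm (h x') \<le> norm (t *\<^sub>R u) * k'"
      using d'(2)[of x x'] d'(1) hx u by (simp add: x'_def blinfun.scaleR_right)
    also have "\<dots> = e * t / (2 * K) * (norm u / (norm u + 1))"
      using elim(3) by (simp add: k'_def)
    also have "\<dots> \<le> e * t / (2 * K) * 1"
      using e K(1) elim(3) by (intro mult_left_mono) (auto simp: divide_le_eq_1 add_nonneg_pos)
    finally have small: "norm (h x') * 2 * K \<le> e * t"
      using K(1) by (simp add: field_simps)
    \<comment> \<open>The radius is twice the norm of \<phi> 0 = -h x', so a map with contraction
      factor 1/2 sends the ball into itself.\<close>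
    define B where "B = cball (0::'b) (2 * norm (h x'))"
    define \<phi> where "\<phi> = (\<lambda>w. w - h (x' + T w))"
    have Tw: "norm (T w) \<le> e * t" if "w \<in> B" for w
    proof -
      have "norm (T w) \<le> (2 * norm (h x')) * K"
        using that K(1) by (intro order_trans[OF K(2)] mult_right_mono) (auto simp: B_def)
      then show ?thesis using small by simp
    qed
    then have inb: "x' + T w \<in> ball x d" if "w \<in> B" for w
      using elim(1) that by (simp add: x'_def)
    have lip: "norm (\<phi> v - \<phi> w) \<le> 1/2 * norm (v - w)" if "v \<in> B" "w \<in> B" for v w
    proof -
      have "\<phi> v - \<phi> w = - (h (x' + T v) - h (x' + T w) - h' x ((x' + T v) - (x' + T w)))"
        by (simp add: \<phi>_def blinfun.diff_right T(2))
      then have "norm (\<phi> v - \<phi> w) \<le> norm ((x' + T v) - (x' + T w)) * k"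
        using d(2)[OF inb[OF that(2)] inb[OF that(1)]] by (simp only: norm_minus_cancel)
      also have "(x' + T v) - (x' + T w) = T (v - w)" by (simp add: T.diff)
      also have "norm (T (v - w)) * k \<le> (norm (v - w) * K) * k"
        using K k by (intro mult_right_mono) auto
      finally show ?thesis using K(1) by (simp add: k_def)
    qed
    have "\<exists>!w\<in>B. \<phi> w = w"
    proof (rule Banach_fix[where c = "1/2"])
      show "complete B" "B \<noteq> {}" by (auto simp: B_def complete_eq_closed)
      show "\<phi> ` B \<subseteq> B"
      proof (rule image_subsetI)
        fix w assume w: "w \<in> B"
        have "0 \<in> B" by (simp add: B_def)
        then have "norm (\<phi> w - \<phi> 0) \<le> 1/2 * norm w" using lip[OF w, of 0] by simp
        then have "norm (\<phi> w) \<le> norm (\<phi> 0) + 1/2 * norm w"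
          using norm_triangle_ineq2[of "\<phi> w" "\<phi> 0"] by linarith
        then show "\<phi> w \<in> B" using w by (simp add: B_def \<phi>_def T.zero)
      qed
      show "dist (\<phi> v) (\<phi> w) \<le> 1/2 * dist v w" if "v \<in> B" "w \<in> B" for v w
        using lip[OF that] by (simp add: dist_norm)
    qed auto
    then obtain w where "w \<in> B" "h (x' + T w) = 0"
      by (auto simp: \<phi>_def)
    then show ?case using Tw by (auto simp: x'_def)
  qed
qed

section \<open>Dini derivatives of Lipschitz functions\<close>

lemma lipschitz_quotient_bound:
  fixes f :: "'a::real_normed_vector \<Rightarrow> real"
  assumes U: "open U" "x \<in> U" and f: "L-lipschitz_on U f"
  shows "\<forall>\<^sub>F t in at_right 0. \<bar>(f (x + t *\<^sub>R u) - f x) / t - (f (x + t *\<^sub>R v) - f x) / t\<bar> \<le> L * norm (u - v)"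
proof -
  have "\<forall>\<^sub>F t in at_right 0. \<forall>r. norm r \<le> 0 * t \<longrightarrow> x + t *\<^sub>R u + r \<in> U"
    "\<forall>\<^sub>F t in at_right 0. \<forall>r. norm r \<le> 0 * t \<longrightarrow> x + t *\<^sub>R v + r \<in> U"
    by (intro eventually_ray_in_open U)+
  moreover have "\<forall>\<^sub>F t in at_right (0::real). t > 0"
    by (rule eventually_at_right_less)
  ultimately show ?thesis
  proof eventually_elim
    case (elim t)
    have "\<bar>f (x + t *\<^sub>R u) - f (x + t *\<^sub>R v)\<bar> \<le> L * dist (x + t *\<^sub>R u) (x + t *\<^sub>R v)"
      using lipschitz_onD[OF f, of "x + t *\<^sub>R u" "x + t *\<^sub>R v"] elim by (simp add: dist_real_def)
    also have "dist (x + t *\<^sub>R u) (x + t *\<^sub>R v) = t * norm (u - v)"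
      using elim by (simp add: dist_norm flip: scaleR_diff_right)
    finally have "\<bar>f (x + t *\<^sub>R u) - f (x + t *\<^sub>R v)\<bar> / t \<le> L * norm (u - v)"
      using elim by (simp add: field_simps)
    moreover have "(f (x + t *\<^sub>R u) - f x) / t - (f (x + t *\<^sub>R v) - f x) / t
        = (f (x + t *\<^sub>R u) - f (x + t *\<^sub>R v)) / t"
      by (simp flip: diff_divide_distrib)
    ultimately show ?case using elim by (simp add: abs_divide)
  qed
qed

text \<open>Comparison with direction 0, whose quotient vanishes, confines the quotients to
  [-L * norm u, L * norm u], hence the lower limit is real. The last conclusion is the form in which
  the lower limit is used for ascent.\<close>

lemma lower_dini_lipschitz:
  fixes f :: "'a::real_normed_vector \<Rightarrow> real"
  assumes U: "open U" "x \<in> U" and f: "L-lipschitz_on U f"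
  obtains D where "\<And>u. lower_dini f x u = ereal (D u)"
    "\<And>u v. D u \<le> D v + L * norm (u - v)"
    "\<And>c u. c > 0 \<Longrightarrow> D (c *\<^sub>R u) = c * D u"
    "\<And>c u. c < D u \<Longrightarrow> \<forall>\<^sub>F t in at_right 0. c < (f (x + t *\<^sub>R u) - f x) / t"
proof -
  define Q where "Q = (\<lambda>u t. (f (x + t *\<^sub>R u) - f x) / t)"
  have Q: "\<forall>\<^sub>F t in at_right 0. \<bar>Q u t - Q v t\<bar> \<le> L * norm (u - v)" for u v
    unfolding Q_def by (rule lipschitz_quotient_bound[OF assms])
  have Q0: "Q 0 t = 0" for t by (simp add: Q_def)
  have dini: "lower_dini f x u = Liminf (at_right 0) (\<lambda>t. ereal (Q u t))" for u
    by (simp add: lower_dini_def Q_def)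
  have "\<exists>d. lower_dini f x u = ereal d" for u
  proof -
    have bound: "\<forall>\<^sub>F t in at_right 0. \<bar>Q u t\<bar> \<le> L * norm u"
      using Q[of u 0] by (simp add: Q0)
    have "\<forall>\<^sub>F t in at_right 0. ereal (- (L * norm u)) \<le> ereal (Q u t)"
      using bound by eventually_elim (simp add: abs_le_iff)
    then have "ereal (- (L * norm u)) \<le> lower_dini f x u"
      unfolding dini by (rule Liminf_bounded)
    moreover have "\<forall>\<^sub>F t in at_right 0. ereal (Q u t) \<le> ereal (L * norm u)"
      using bound by eventually_elim (simp add: abs_le_iff)
    then have "lower_dini f x u \<le> Liminf (at_right (0::real)) (\<lambda>t. ereal (L * norm u))"
      unfolding dini by (rule Liminf_mono)
    ultimately show ?thesis
      by (cases "lower_dini f x u") (auto simp: Liminf_const)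
  qed
  then obtain D where D: "\<And>u. lower_dini f x u = ereal (D u)" by metis
  have geD: "\<forall>\<^sub>F t in at_right 0. c < Q u t" if "c < D u" for c u
  proof -
    have "\<forall>\<^sub>F t in at_right 0. ereal c < ereal (Q u t)"
      using that D[of u] unfolding dini by (intro less_LiminfD) simp
    then show ?thesis by simp
  qed
  have geI: "c \<le> D u" if "\<And>b. b < c \<Longrightarrow> \<forall>\<^sub>F t in at_right 0. b \<le> Q u t" for c u
  proof (rule dense_le)
    fix b assume "b < c"
    have "ereal b \<le> lower_dini f x u"
      unfolding dini using that[OF \<open>b < c\<close>] by (intro Liminf_bounded) simp
    then show "b \<le> D u" using D by simp
  qed
  have scale: "c * D u \<le> D (c *\<^sub>R u)" if c: "c > 0" for c u
  proof (rule geI)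
    fix b assume "b < c * D u"
    then have "\<forall>\<^sub>F t in at_right 0. b / c < Q u t"
      using c by (intro geD) (simp add: field_simps)
    then obtain a where a: "a > 0" "\<And>t. 0 < t \<Longrightarrow> t < a \<Longrightarrow> b / c < Q u t"
      by (auto simp: eventually_at_right_field)
    \<comment> \<open>The quotient in direction c u at time t is c times the quotient in direction u
      at time t * c, so the threshold a becomes a / c.\<close>
    have "b \<le> Q (c *\<^sub>R u) t" if "0 < t" "t < a / c" for t
    proof -
      have "b / c < Q u (t * c)" using a(2)[of "t * c"] that c by (simp add: field_simps)
      then show ?thesis using that c by (simp add: Q_def field_simps)
    qed
    then show "\<forall>\<^sub>F t in at_right 0. b \<le> Q (c *\<^sub>R u) t"
      unfolding eventually_at_right_field using a(1) c by (intro exI[of _ "a / c"]) simp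
  qed
  show thesis
  proof (rule that[of D])
    show "lower_dini f x u = ereal (D u)" for u by (rule D)
    show "D u \<le> D v + L * norm (u - v)" for u v
    proof -
      have "D u - L * norm (u - v) \<le> D v"
      proof (rule geI)
        fix b assume "b < D u - L * norm (u - v)"
        then have "\<forall>\<^sub>F t in at_right 0. b + L * norm (u - v) < Q u t"
          by (intro geD) simp
        then show "\<forall>\<^sub>F t in at_right 0. b \<le> Q v t"
          using Q[of u v] by eventually_elim linarith
      qed
      then show ?thesis by simp
    qed
    show "D (c *\<^sub>R u) = c * D u" if c: "c > 0" for c u
      using scale[OF c, of u] scale[of "inverse c" "c *\<^sub>R u"] c by (simp add: field_simps)
    show "\<forall>\<^sub>F t in at_right 0. c < (f (x + t *\<^sub>R u) - f x) / t" if "c < D u" for c u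
      using geD[OF that] by (simp add: Q_def)
  qed
qed

text \<open>Superadditivity of the infimum comes from splitting D (u + v + w) - D w at D (v + w).
  The Lipschitz bound on D keeps the infimum finite, and w = 0 transfers the ascent property of
  D.\<close>

lemma modified_lower_dini_lipschitz:
  fixes f :: "'a::real_normed_vector \<Rightarrow> real"
  assumes U: "open U" "x \<in> U" and f: "L-lipschitz_on U f"
  obtains \<phi> where "sublinear \<phi>" "\<And>u. modified_lower_dini f x u = ereal (- \<phi> u)"
    "\<And>u. \<phi> u \<le> L * norm u"
    "\<And>c u. c < - \<phi> u \<Longrightarrow> \<forall>\<^sub>F t in at_right 0. c < (f (x + t *\<^sub>R u) - f x) / t"
proof -
  obtain D where D: "\<And>u. lower_dini f x u = ereal (D u)"
    and lip: "\<And>u v. D u \<le> D v + L * norm (u - v)"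
    and scale: "\<And>c u. c > 0 \<Longrightarrow> D (c *\<^sub>R u) = c * D u"
    and ev: "\<And>c u. c < D u \<Longrightarrow> \<forall>\<^sub>F t in at_right 0. c < (f (x + t *\<^sub>R u) - f x) / t"
    using lower_dini_lipschitz[OF assms] by blast
  define p where "p = (\<lambda>u. INF w. D (u + w) - D w)"
  have bound: "- (L * norm u) \<le> D (u + w) - D w" for u w
    using lip[of w "u + w"] by (simp add: norm_minus_commute)
  then have bdd: "bdd_below (range (\<lambda>w. D (u + w) - D w))" for u
    by (intro bdd_belowI2) auto
  have low: "p u \<le> D (u + w) - D w" for u w
    unfolding p_def by (rule cINF_lower[OF bdd]) simp
  have great: "c \<le> p u" if "\<And>w. c \<le> D (u + w) - D w" for c u
    unfolding p_def using that by (intro cINF_greatest) auto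
  have D0: "D 0 = 0" using scale[of 2 0] by simp
  have pscale: "c * p u \<le> p (c *\<^sub>R u)" if c: "c > 0" for c u
  proof (rule great)
    fix w
    have "c * p u \<le> c * (D (u + (1 / c) *\<^sub>R w) - D ((1 / c) *\<^sub>R w))"
      using low c by simp
    also have "\<dots> = D (c *\<^sub>R (u + (1 / c) *\<^sub>R w)) - D (c *\<^sub>R (1 / c) *\<^sub>R w)"
      using c by (simp only: scale right_diff_distrib)
    also have "\<dots> = D (c *\<^sub>R u + w) - D w"
      using c by (simp add: scaleR_right_distrib)
    finally show "c * p u \<le> D (c *\<^sub>R u + w) - D w" .
  qed
  show thesis
  proof (rule that[of "\<lambda>u. - p u"])
    show "sublinear (\<lambda>u. - p u)"
    proof (rule sublinearI)
      fix u v
      have "p u + p v \<le> p (u + v)"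
      proof (rule great)
        fix w
        show "p u + p v \<le> D (u + v + w) - D w"
          using low[of u "v + w"] low[of v w] by (simp add: add.assoc)
      qed
      then show "- p (u + v) \<le> - p u + - p v" by simp
    next
      fix c :: real and u assume c: "c > 0"
      show "- p (c *\<^sub>R u) = c * - p u"
        using pscale[OF c, of u] pscale[of "inverse c" "c *\<^sub>R u"] c by (simp add: field_simps)
    qed
    show "modified_lower_dini f x u = ereal (- (- p u))" for u
      using ereal_Inf'[OF bdd[of u]] by (simp add: modified_lower_dini_def D p_def image_image)
    show "- p u \<le> L * norm u" for u
      using great[OF bound] by (simp add: minus_le_iff)
    show "\<forall>\<^sub>F t in at_right 0. c < (f (x + t *\<^sub>R u) - f x) / t" if "c < - (- p u)" for c u
      using that low[of u 0] by (intro ev) (simp add: D0)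
  qed
qed

text \<open>The ray gains more than c * t, while a displacement of norm at most e * t costs at most
  L * e * t \<le> c * t for e = c / (L + 1); the + 1 covers L = 0.\<close>

lemma increase_along_perturbed_ray:
  fixes f :: "'a::real_normed_vector \<Rightarrow> real"
  assumes U: "open U" "x \<in> U" and f: "L-lipschitz_on U f"
    and c: "c > 0" "\<forall>\<^sub>F t in at_right 0. c < (f (x + t *\<^sub>R u) - f x) / t"
  obtains e where "e > 0"
    "\<forall>\<^sub>F t in at_right 0. \<forall>r. norm r \<le> e * t \<longrightarrow> f (x + t *\<^sub>R u + r) > f x"
proof -
  define e where "e = c / (L + 1)"
  have L: "L \<ge> 0" using f by (rule lipschitz_on_nonneg)
  have e: "e > 0" "L * e \<le> c" using c(1) L by (auto simp: e_def field_simps)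
  have "\<forall>\<^sub>F t in at_right 0. \<forall>r. norm r \<le> e * t \<longrightarrow> x + t *\<^sub>R u + r \<in> U"
    by (intro eventually_ray_in_open U)
  moreover have "\<forall>\<^sub>F t in at_right (0::real). t > 0"
    by (rule eventually_at_right_less)
  ultimately have "\<forall>\<^sub>F t in at_right 0. \<forall>r. norm r \<le> e * t \<longrightarrow> f (x + t *\<^sub>R u + r) > f x"
    using c(2)
  proof eventually_elim
    case (elim t)
    have "f (x + t *\<^sub>R u + r) > f x" if r: "norm r \<le> e * t" for r
    proof -
      have "x + t *\<^sub>R u \<in> U" using elim(1)[rule_format, of 0] elim(2) e(1) by simp
      then have "\<bar>f (x + t *\<^sub>R u + r) - f (x + t *\<^sub>R u)\<bar> \<le> L * norm r"
        using lipschitz_onD[OF f, of "x + t *\<^sub>R u + r" "x + t *\<^sub>R u"] elim(1) r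
        by (simp add: dist_norm)
      also have "\<dots> \<le> L * (e * t)" using r L by (rule mult_left_mono)
      also have "\<dots> \<le> c * t" using mult_right_mono[OF e(2), of t] elim(2) by (simp add: mult.assoc)
      also have "\<dots> < f (x + t *\<^sub>R u) - f x" using elim(2,3) by (simp add: field_simps)
      finally show ?thesis by linarith
    qed
    then show ?case by blast
  qed
  with e(1) show thesis by (rule that)
qed

section \<open>Multipliers\<close>

text \<open>Multipliers on the kernel lift to the whole space: \<open>w\<^sub>0\<close> is a linear functional below the
  value function \<open>w \<mapsto> inf {q u | A u = w}\<close>.\<close>

lemma sublinear_kernel_multiplier:
  fixes q :: "'a::real_normed_vector \<Rightarrow> real" and A :: "'a \<Rightarrow> 'b::real_normed_vector"
  assumes q: "sublinear q" "\<And>u. q u \<le> C * norm u"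
    and A: "bounded_linear A" and T: "bounded_linear T" "\<And>w. A (T w) = w"
    and nonneg: "\<And>u. A u = 0 \<Longrightarrow> q u \<ge> 0"
  obtains g :: "'b \<Rightarrow>\<^sub>L real" where "\<And>u. blinfun_apply g (A u) \<le> q u"
proof -
  interpret A: bounded_linear A by fact
  interpret T: bounded_linear T by fact
  define P where "P = (\<lambda>w. INF u\<in>{u. A u = w}. q u)"
  \<comment> \<open>Subtracting T w moves u into the kernel, where q is nonnegative; this bounds q
    from below on the whole fibre over w.\<close>
  have bound: "- q (- T w) \<le> q u" if "A u = w" for u w
  proof -
    have "A (u + - T w) = 0" using that by (simp add: A.diff T(2))
    then have "0 \<le> q (u + - T w)" by (rule nonneg)
    also have "\<dots> \<le> q u + q (- T w)" by (rule sublinear_add[OF q(1)])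
    finally show ?thesis by simp
  qed
  have bdd: "bdd_below (q ` {u. A u = w})" for w
    by (rule bdd_belowI2[where m = "- q (- T w)"]) (use bound in blast)
  have low: "P (A u) \<le> q u" for u
    unfolding P_def by (rule cINF_lower[OF bdd]) simp
  have great: "c \<le> P w" if "\<And>u. A u = w \<Longrightarrow> c \<le> q u" for c w
    unfolding P_def by (rule cINF_greatest) (use that T(2)[of w] in blast)+
  have scale: "c * P w \<le> P (c *\<^sub>R w)" if c: "c > 0" for c w
  proof (rule great)
    fix u assume "A u = c *\<^sub>R w"
    then have "A ((1 / c) *\<^sub>R u) = w" using c by (simp add: A.scaleR)
    then have "P w \<le> q ((1 / c) *\<^sub>R u)" using low by metis
    then show "c * P w \<le> q u" using c by (simp add: sublinear_scaleR_pos[OF q(1)] field_simps)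
  qed
  have "sublinear P"
  proof (rule sublinearI)
    fix v w
    have "P (v + w) \<le> q a + q b" if "A a = v" "A b = w" for a b
      using low[of "a + b"] sublinear_add[OF q(1), of a b] that by (simp add: A.add)
    then have "P (v + w) - q b \<le> P v" if "A b = w" for b
      using that by (intro great) (simp add: diff_le_eq)
    then have "P (v + w) - P v \<le> P w"
      by (intro great) (simp add: algebra_simps)
    then show "P (v + w) \<le> P v + P w" by simp
  next
    fix c :: real and w assume c: "c > 0"
    show "P (c *\<^sub>R w) = c * P w"
      using scale[OF c, of w] scale[of "inverse c" "c *\<^sub>R w"] c by (simp add: field_simps)
  qed
  then obtain f where f: "linear f" "\<And>w. f w \<le> P w"
    using sublinear_dominates_linear by blast
  obtain K where K: "K > 0" "\<And>w. norm (T w) \<le> norm w * K"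
    using T.pos_bounded by blast
  have f_le: "f w \<le> norm w * (\<bar>C\<bar> * K)" for w
  proof -
    have "f w \<le> P (A (T w))" using f(2) T(2) by simp
    also have "\<dots> \<le> q (T w)" by (rule low)
    also have "\<dots> \<le> C * norm (T w)" by (rule q(2))
    also have "\<dots> \<le> \<bar>C\<bar> * norm (T w)" by (intro mult_right_mono) auto
    also have "\<dots> \<le> \<bar>C\<bar> * (norm w * K)" using K by (intro mult_left_mono) auto
    finally show ?thesis by (simp add: mult_ac)
  qed
  have "norm (f w) \<le> norm w * (\<bar>C\<bar> * K)" for w
    using f_le[of w] f_le[of "- w"] linear_neg[OF f(1), of w] by (simp add: abs_le_iff)
  then have "bounded_linear f"
    using f(1) by (intro bounded_linear_intro[where K = "\<bar>C\<bar> * K"]) (auto simp: linear_add linear_scale)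
  then show thesis
    using f(2) low by (intro that[of "Blinfun f"]) (auto simp: bounded_linear_Blinfun_apply intro: order_trans)
qed

text \<open>The objective and the active constraints increase strictly even after a displacement of
  size e i * t, and the inactive constraints stay positive by continuity. A correction below the
  smallest of these finitely many tolerances restores h = 0, producing a feasible point better than
  x.\<close>

lemma no_common_ascent_direction:
  fixes f :: "nat \<Rightarrow> 'a::banach \<Rightarrow> real" and h :: "'a \<Rightarrow> 'b::banach"
    and h' :: "'a \<Rightarrow> 'a \<Rightarrow>\<^sub>L 'b"
  assumes \<Omega>: "open \<Omega>" "x \<in> \<Omega>" and feasible: "\<And>i. i \<in> {1..m} \<Longrightarrow> f i x \<ge> 0" "h x = 0"
    and optimal: "\<And>y. y \<in> \<Omega> \<Longrightarrow> (\<And>i. i \<in> {1..m} \<Longrightarrow> f i y \<ge> 0) \<Longrightarrow> h y = 0 \<Longrightarrow> f 0 y \<le> f 0 x"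
    and lipschitz: "\<And>i. i \<in> {0..m} \<Longrightarrow> \<exists>U C. open U \<and> x \<in> U \<and> C-lipschitz_on U (f i)"
    and U: "open U" "x \<in> U"
    and der: "\<And>y. y \<in> U \<Longrightarrow> (h has_derivative blinfun_apply (h' y)) (at y)"
    and cont: "isCont h' x"
    and T: "bounded_linear T" "\<And>w. h' x (T w) = w"
    and u: "h' x u = 0"
    and ascent: "\<And>i. i \<in> insert 0 {i\<in>{1..m}. f i x = 0} \<Longrightarrow>
      \<exists>c>0. \<forall>\<^sub>F t in at_right 0. c < (f i (x + t *\<^sub>R u) - f i x) / t"
  shows False
proof -
  define G where "G = (\<lambda>i y. if i = 0 then f 0 x < f 0 y else 0 \<le> f i y)"
  have "\<exists>e>0. \<forall>\<^sub>F t in at_right 0. \<forall>r. norm r \<le> e * t \<longrightarrow> G i (x + t *\<^sub>R u + r)"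
    if i: "i \<in> {0..m}" for i
  proof -
    obtain V C where V: "open V" "x \<in> V" "C-lipschitz_on V (f i)"
      using lipschitz[OF i] by blast
    show ?thesis
    proof (cases "i \<in> insert 0 {i\<in>{1..m}. f i x = 0}")
      case True
      then obtain c where "c > 0" "\<forall>\<^sub>F t in at_right 0. c < (f i (x + t *\<^sub>R u) - f i x) / t"
        using ascent by blast
      then obtain e where "e > 0"
        and ev: "\<forall>\<^sub>F t in at_right 0. \<forall>r. norm r \<le> e * t \<longrightarrow> f i x < f i (x + t *\<^sub>R u + r)"
        using increase_along_perturbed_ray[OF V] by blast
      have "\<forall>\<^sub>F t in at_right 0. \<forall>r. norm r \<le> e * t \<longrightarrow> G i (x + t *\<^sub>R u + r)"
        using ev by eventually_elim (use True in \<open>auto simp: G_def less_imp_le\<close>)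
      with \<open>e > 0\<close> show ?thesis by blast
    next
      case False
      then have pos: "i \<noteq> 0" "f i x > 0"
        using i feasible(1)[of i] by auto
      have "open (V \<inter> f i -` {0<..})"
        using V by (intro continuous_open_preimage lipschitz_on_continuous_on) auto
      then have "\<forall>\<^sub>F t in at_right 0. \<forall>r. norm r \<le> 1 * t \<longrightarrow> x + t *\<^sub>R u + r \<in> V \<inter> f i -` {0<..}"
        by (rule eventually_ray_in_open) (use pos V in simp)
      then have "\<forall>\<^sub>F t in at_right 0. \<forall>r. norm r \<le> 1 * t \<longrightarrow> G i (x + t *\<^sub>R u + r)"
        by eventually_elim (use pos in \<open>auto simp: G_def less_imp_le\<close>)
      then show ?thesis by (intro exI[of _ 1]) simp
    qed
  qed
  then have "\<exists>e. \<forall>i\<in>{0..m}. e i > 0 \<and>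
      (\<forall>\<^sub>F t in at_right 0. \<forall>r. norm r \<le> e i * t \<longrightarrow> G i (x + t *\<^sub>R u + r))"
    by (intro bchoice ballI)
  then obtain e where e: "\<And>i. i \<in> {0..m} \<Longrightarrow> e i > 0"
    "\<And>i. i \<in> {0..m} \<Longrightarrow> \<forall>\<^sub>F t in at_right 0. \<forall>r. norm r \<le> e i * t \<longrightarrow> G i (x + t *\<^sub>R u + r)"
    by blast
  define e0 where "e0 = Min (e ` {0..m})"
  have e0: "e0 > 0" using e(1) by (simp add: e0_def)
  have e0_le: "e0 \<le> e i" if "i \<in> {0..m}" for i
    using that by (simp add: e0_def)
  have "\<forall>\<^sub>F t in at_right 0. \<forall>i\<in>{0..m}. \<forall>r. norm r \<le> e i * t \<longrightarrow> G i (x + t *\<^sub>R u + r)"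
    using e(2) by (intro eventually_ball_finite) auto
  moreover have "\<forall>\<^sub>F t in at_right 0. \<forall>r. norm r \<le> e0 * t \<longrightarrow> x + t *\<^sub>R u + r \<in> \<Omega>"
    by (intro eventually_ray_in_open \<Omega>)
  moreover have "\<forall>\<^sub>F t in at_right 0. \<exists>r. norm r \<le> e0 * t \<and> h (x + t *\<^sub>R u + r) = 0"
    by (rule kernel_direction_tangent[OF U der cont T feasible(2) u e0])
  moreover have "\<forall>\<^sub>F t in at_right (0::real). t > 0"
    by (rule eventually_at_right_less)
  ultimately have "\<forall>\<^sub>F t in at_right (0::real). False"
  proof eventually_elim
    case (elim t)
    then obtain r where r: "norm r \<le> e0 * t" "h (x + t *\<^sub>R u + r) = 0" by blast
    define y where "y = x + t *\<^sub>R u + r"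
    have G: "G i y" if "i \<in> {0..m}" for i
    proof -
      have "norm r \<le> e i * t"
        using r(1) mult_right_mono[OF e0_le[OF that], of t] elim(4) by linarith
      then show ?thesis using elim(1) that by (simp add: y_def)
    qed
    have "f 0 y \<le> f 0 x"
    proof (rule optimal)
      show "f i y \<ge> 0" if "i \<in> {1..m}" for i
        using G[of i] that by (auto simp: G_def split: if_splits)
    qed (use elim r in \<open>auto simp: y_def\<close>)
    then show False using G[of 0] by (simp add: G_def)
  qed
  then show False by (simp add: trivial_limit_at_right_real)
qed

theorem theorem4p1:
  fixes \<Omega> :: "'a::banach set"
    and f :: "nat \<Rightarrow> 'a \<Rightarrow> real"
    and h :: "'a \<Rightarrow> 'b::banach"
    and h' :: "'a \<Rightarrow> ('a \<Rightarrow>\<^sub>L 'b)"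
    and m :: nat
    and xhat :: 'a
  assumes open_\<Omega>: "open \<Omega>"
    and feasible: "xhat \<in> \<Omega>" "\<forall>i\<in>{1..m}. f i xhat \<ge> 0" "h xhat = 0"
    and optimal: "\<forall>x\<in>\<Omega>. (\<forall>i\<in>{1..m}. f i x \<ge> 0) \<and> h x = 0 \<longrightarrow> f 0 x \<le> f 0 xhat"
    and lipschitz: "\<forall>i\<in>{0..m}. \<exists>U C. open U \<and> xhat \<in> U \<and> C-lipschitz_on U (f i)"
    and frechet: "\<exists>U. open U \<and> xhat \<in> U \<and> (\<forall>x\<in>U. (h has_derivative blinfun_apply (h' x)) (at x))"
    and deriv_cont: "isCont h' xhat"
    and closed_image: "closed (range (blinfun_apply (h' xhat)))"
    and complemented: "\<exists>E1. closed E1 \<and> subspace E1 \<and>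
        {u. blinfun_apply (h' xhat) u = 0} \<inter> E1 = {0} \<and>
        (\<forall>x. \<exists>k e. blinfun_apply (h' xhat) k = 0 \<and> e \<in> E1 \<and> x = k + e)"
  shows "\<exists>(lam :: nat \<Rightarrow> real) (w0 :: 'b \<Rightarrow>\<^sub>L real).
      (\<forall>i\<in>{0..m}. lam i \<ge> 0)
    \<and> ((\<exists>i\<in>{0..m}. lam i \<noteq> 0) \<or> w0 \<noteq> 0)
    \<and> (\<forall>i\<in>{1..m}. lam i * f i xhat = 0)
    \<and> (\<forall>u. (\<Sum>i\<in>{0..m}. ereal (lam i) * modified_lower_dini (f i) xhat u)
              + ereal (blinfun_apply w0 (blinfun_apply (h' xhat) u)) \<le> 0)
    \<and> (\<not> surj (blinfun_apply (h' xhat)) \<longrightarrow> (\<forall>i\<in>{0..m}. lam i = 0) \<and> w0 \<noteq> 0)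
    \<and> (surj (blinfun_apply (h' xhat)) \<longrightarrow>
          (\<exists>i\<in>{0..m}. lam i \<noteq> 0)
        \<and> ((\<exists>w. blinfun_apply (h' xhat) w = 0 \<and>
               (\<forall>j\<in>{i\<in>{1..m}. f i xhat = 0}. modified_lower_dini (f j) xhat w > 0))
             \<longrightarrow> lam 0 = 1))"
proof -
  define A where "A = blinfun_apply (h' xhat)"
  have A: "bounded_linear A" by (simp add: A_def blinfun.bounded_linear_right)
  interpret A: bounded_linear A by fact
  show ?thesis
  proof (cases "surj A")
    case False
    have "subspace (range A)"
      by (simp add: A.linear linear_subspace_image)
    then obtain g :: "'b \<Rightarrow>\<^sub>L real"
      where g: "g \<noteq> 0" "\<And>w. w \<in> range A \<Longrightarrow> blinfun_apply g w = 0"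
      using closed_subspace_annihilator[of "range A"] closed_image[folded A_def] False by metis
    \<comment> \<open>In \<open>ereal\<close> the product of 0 with any value, infinite ones
      included, is 0.\<close>
    have "(\<Sum>i\<in>{0..m}. ereal 0 * modified_lower_dini (f i) xhat u) = 0" for u
      by (intro sum.neutral) (simp flip: zero_ereal_def)
    then have "(\<Sum>i\<in>{0..m}. ereal 0 * modified_lower_dini (f i) xhat u)
        + ereal (blinfun_apply g (A u)) \<le> 0" for u
      using g(2)[of "A u"] by simp
    with False g(1) show ?thesis
      unfolding A_def[symmetric]
      by (intro exI[of _ "\<lambda>_. 0"] exI[of _ g]) ((simp only: mult_zero_left order_refl simp_thms), blast)
  next
    case True
    obtain E1 where E1: "closed E1" "subspace E1" "{u. A u = 0} \<inter> E1 = {0}"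
      "\<And>x. \<exists>k e. A k = 0 \<and> e \<in> E1 \<and> x = k + e"
      using complemented[folded A_def] by blast
    obtain T where T: "bounded_linear T" "\<And>w. A (T w) = w"
      using bounded_right_inverse[OF A True E1(2,1,3,4)] by blast
    obtain U where U: "open U" "xhat \<in> U"
      "\<And>y. y \<in> U \<Longrightarrow> (h has_derivative blinfun_apply (h' y)) (at y)"
      using frechet by blast
    let ?ascends = "\<lambda>i u c. \<forall>\<^sub>F t in at_right 0. c < (f i (xhat + t *\<^sub>R u) - f i xhat) / t"
    let ?P = "\<lambda>i \<phi> L. sublinear \<phi> \<and> (\<forall>u. modified_lower_dini (f i) xhat u = ereal (- \<phi> u)) \<and>
        (\<forall>u. \<phi> u \<le> L * norm u) \<and> (\<forall>c u. c < - \<phi> u \<longrightarrow> ?ascends i u c)"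
    have "\<exists>\<phi> L. ?P i \<phi> L" if i: "i \<in> {0..m}" for i
    proof -
      obtain V C where V: "open V" "xhat \<in> V" "C-lipschitz_on V (f i)"
        using lipschitz i by blast
      show ?thesis
        by (rule modified_lower_dini_lipschitz[OF V]) blast
    qed
    then have "\<exists>\<phi>. \<forall>i\<in>{0..m}. \<exists>L. ?P i (\<phi> i) L"
      by (intro bchoice ballI)
    then obtain \<phi> where "\<forall>i\<in>{0..m}. \<exists>L. ?P i (\<phi> i) L" ..
    then have "\<exists>L. \<forall>i\<in>{0..m}. ?P i (\<phi> i) (L i)"
      by (rule bchoice)
    then obtain L where P: "\<forall>i\<in>{0..m}. ?P i (\<phi> i) (L i)" ..
    then have sub: "\<And>i. i \<in> {0..m} \<Longrightarrow> sublinear (\<phi> i)"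
      and dini: "\<And>i u. i \<in> {0..m} \<Longrightarrow> modified_lower_dini (f i) xhat u = ereal (- \<phi> i u)"
      and L: "\<And>i u. i \<in> {0..m} \<Longrightarrow> \<phi> i u \<le> L i * norm u"
      and ascends: "\<And>i c u. i \<in> {0..m} \<Longrightarrow> c < - \<phi> i u \<Longrightarrow> ?ascends i u c"
      by blast+
    \<comment> \<open>Only the objective and the active constraints receive multipliers; the value 0
      elsewhere gives complementary slackness.\<close>
    define J where "J = insert 0 {i\<in>{1..m}. f i xhat = 0}"
    have J: "J \<subseteq> {0..m}" "finite J" "0 \<in> J" by (auto simp: J_def)
    have none: "\<not> (\<exists>u\<in>{u. A u = 0}. \<forall>i\<in>J. \<phi> i u < 0)"
    proof
      assume "\<exists>u\<in>{u. A u = 0}. \<forall>i\<in>J. \<phi> i u < 0"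
      then obtain u where u: "A u = 0" "\<And>i. i \<in> J \<Longrightarrow> \<phi> i u < 0" by blast
      show False
      proof (rule no_common_ascent_direction[of \<Omega> xhat m f h U h' T u])
        fix i assume i: "i \<in> insert 0 {i\<in>{1..m}. f i xhat = 0}"
        then have "\<phi> i u < 0" "i \<in> {0..m}" using u(2)[of i] J(1) by (auto simp: J_def)
        then show "\<exists>c>0. ?ascends i u c"
          using ascends[of i "- \<phi> i u / 2" u] by (intro exI[of _ "- \<phi> i u / 2"]) simp
      qed (use assms U T u in \<open>auto simp: A_def\<close>)
    qed
    have "\<exists>l. (\<forall>i\<in>J. l i \<ge> (0::real)) \<and> (\<exists>i\<in>J. l i \<noteq> 0) \<and>
        (\<forall>u\<in>{u. A u = 0}. (\<Sum>i\<in>J. l i * \<phi> i u) \<ge> 0)"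
      by (rule sublinear_alternative)
        (use J sub none in \<open>auto simp: A.add A.scaleR\<close>)
    then obtain l where l: "\<And>i. i \<in> J \<Longrightarrow> l i \<ge> (0::real)" "\<exists>i\<in>J. l i \<noteq> 0"
      "\<And>u. A u = 0 \<Longrightarrow> (\<Sum>i\<in>J. l i * \<phi> i u) \<ge> 0"
      by auto
    \<comment> \<open>Dividing by l 0 normalises the objective's multiplier to 1 whenever it is
      nonzero.\<close>
    define s where "s = (if l 0 = 0 then 1 else l 0)"
    have s: "s > 0" using l(1)[OF J(3)] by (simp add: s_def)
    define lam where "lam = (\<lambda>i. if i \<in> J then l i / s else 0)"
    have lam: "lam i \<ge> 0" for i using l(1) s by (simp add: lam_def)
    define q where "q = (\<lambda>u. \<Sum>i\<in>{0..m}. lam i * \<phi> i u)"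
    have q_eq: "q u = (\<Sum>i\<in>J. l i * \<phi> i u) / s" for u
    proof -
      have "q u = (\<Sum>i\<in>J. lam i * \<phi> i u)"
        unfolding q_def using J(1) by (intro sum.mono_neutral_right) (auto simp: lam_def)
      then show ?thesis by (simp add: lam_def sum_divide_distrib)
    qed
    have q: "sublinear q"
      unfolding q_def using sub lam by (intro sublinear_sum) auto
    have q_le: "q u \<le> (\<Sum>i\<in>{0..m}. lam i * L i) * norm u" for u
      unfolding q_def sum_distrib_right
      by (intro sum_mono) (simp add: L lam mult_left_mono mult.assoc)
    have q_nonneg: "q u \<ge> 0" if "A u = 0" for u
      using l(3)[OF that] s by (simp add: q_eq)
    obtain g :: "'b \<Rightarrow>\<^sub>L real" where g: "\<And>u. blinfun_apply g (A u) \<le> q u"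
      using sublinear_kernel_multiplier[OF q q_le A T q_nonneg] by blast
    have lam_nz: "\<exists>i\<in>{0..m}. lam i \<noteq> 0"
      using l(2) J(1) s by (auto simp: lam_def)
    have complementary: "lam i * f i xhat = 0" if "i \<in> {1..m}" for i
      using that by (auto simp: lam_def J_def)
    have multiplier: "(\<Sum>i\<in>{0..m}. ereal (lam i) * modified_lower_dini (f i) xhat u)
        + ereal (blinfun_apply g (A u)) \<le> 0" for u
    proof -
      have "(\<Sum>i\<in>{0..m}. ereal (lam i) * modified_lower_dini (f i) xhat u)
          = (\<Sum>i\<in>{0..m}. ereal (- (lam i * \<phi> i u)))"
        by (intro sum.cong) (simp_all add: dini)
      also have "\<dots> = ereal (- q u)"
        by (simp add: q_def sum_negf)
      finally show ?thesis using g[of u] by simp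
    qed
    \<comment> \<open>If l 0 were 0, the combination of the active \<phi> i at the kernel vector w
      would be strictly negative, contradicting its nonnegativity on the kernel.\<close>
    have normal: "lam 0 = 1"
      if w: "A w = 0" "\<forall>j\<in>{i\<in>{1..m}. f i xhat = 0}. modified_lower_dini (f j) xhat w > 0" for w
    proof (cases "l 0 = 0")
      case True
      then obtain j where j: "j \<in> J" "j \<noteq> 0" "l j > 0"
        using l(1,2) by (metis order_less_le)
      have neg: "\<phi> i w < 0" if "i \<in> J - {0}" for i
        using w(2) that dini[of i w] by (auto simp: J_def)
      have "(\<Sum>i\<in>J - {0}. l i * \<phi> i w) < 0"
      proof -
        have "(\<Sum>i\<in>J - {0}. l i * \<phi> i w) < (\<Sum>i\<in>J - {0}. 0)"
        proof (rule sum_strict_mono_ex1)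
          show "\<forall>i\<in>J - {0}. l i * \<phi> i w \<le> 0"
            using l(1) neg by (meson DiffD1 less_imp_le mult_nonneg_nonpos)
          show "\<exists>i\<in>J - {0}. l i * \<phi> i w < 0"
            using j neg by (intro bexI[of _ j] mult_pos_neg) auto
        qed (use J in simp)
        then show ?thesis by simp
      qed
      moreover have "(\<Sum>i\<in>J. l i * \<phi> i w) = (\<Sum>i\<in>J - {0}. l i * \<phi> i w)"
        using J True by (simp add: sum.remove[of J 0])
      ultimately show ?thesis using l(3)[OF w(1)] by simp
    next
      case False
      then show ?thesis using J(3) by (simp add: lam_def s_def)
    qed
    show ?thesis
      unfolding A_def[symmetric] using True lam lam_nz complementary multiplier normal
      by (intro exI[of _ lam] exI[of _ g] conjI) auto
  qed
qed

end
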